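(* Let $W$ be a simply-laced Coxeter group with Coxeter graph $S$, $|S|=n$, and let $\mathbf{W}\subseteq \mathrm{GL}_n(F_2)$ be the flipping group of $S$. Then there exists a surjective homomorphism $\phi:W\rightarrow \mathbf{W}$ such that $\phi(s)=\mathbf{s}$ for all $s\in S$. In particular, $\phi$ is a representation of $W$ over $F_2$.
   Context: A simply-laced Coxeter group $W$ is the group with a finite set of generators $S$, $|S|=n$, subject only to the relations $(ss')^{m(s,s')}=1$ for $s,s'\in S$, where $m(s,s)=1$ and $m(s,s')=m(s',s)\in\{2,3\}$ for $s\neq s'$. Its Coxeter graph (also denoted $S$) has vertex set $S$ and edge set $R=\{ss' : m(s,s')=3\}$. $F_2$ is the field with two elements. For $s\in S$, $\mathbf{s}$ denotes the $n\times n$ matrix over $F_2$, with rows and columns indexed by $S$, whose entries are $\mathbf{s}_{uv}=1$ if $u=v$, or if $v=s$ and $uv\in R$, and $\mathbf{s}_{uv}=0$ otherwise. One has $\mathbf{s}^2=I$, so $\mathbf{s}$ is invertible. The flipping group $\mathbf{W}$ of $S$ is the subgroup of $\mathrm{GL}_n(F_2)$ generated by $\{\mathbf{s} : s\in S\}$. *)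

theory Defs
  imports
    "HOL-Analysis.Finite_Cartesian_Product"
    "HOL-Analysis.Cartesian_Space"
    "HOL-Library.Z2"
    "HOL-Algebra.Generated_Groups"
begin

section \<open>Groups given by generators and relations\<close>

text \<open>
  A word over the generators and their formal inverses is a list of pairs: \<open>(s, True)\<close> stands for
  \<open>s\<close> and \<open>(s, False)\<close> for the inverse of \<open>s\<close>. The group with generating type \<open>'s\<close> and set of
  relators \<open>R\<close> consists of the words modulo the least congruence that cancels adjacent inverse
  letters and identifies every relator with the empty word.
\<close>

type_synonym 's word = "('s \<times> bool) list"

inductive pres_eq :: "'s word set \<Rightarrow> 's word \<Rightarrow> 's word \<Rightarrow> bool" for R where
  refl: "pres_eq R w w"
| sym: "pres_eq R v w \<Longrightarrow> pres_eq R w v"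
| trans: "pres_eq R u v \<Longrightarrow> pres_eq R v w \<Longrightarrow> pres_eq R u w"
| cancel: "pres_eq R (u @ [(s, b), (s, \<not> b)] @ v) (u @ v)"
| relator: "r \<in> R \<Longrightarrow> pres_eq R (u @ r @ v) (u @ v)"

definition pres_rel :: "'s word set \<Rightarrow> ('s word \<times> 's word) set" where
  "pres_rel R = {(v, w). pres_eq R v w}"

definition presented_group :: "'s word set \<Rightarrow> 's word set monoid" where
  "presented_group R =
     \<lparr>carrier = UNIV // pres_rel R,
      mult = (\<lambda>X Y. \<Union>x\<in>X. \<Union>y\<in>Y. pres_rel R `` {x @ y}),
      one = pres_rel R `` {[]}\<rparr>"

definition pres_gen :: "'s word set \<Rightarrow> 's \<Rightarrow> 's word set" where
  "pres_gen R s = pres_rel R `` {[(s, True)]}"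

lemma equiv_pres_rel: "equiv UNIV (pres_rel R)"
  by (rule equivI)
     (auto simp: pres_rel_def refl_on_def sym_on_def trans_on_def
       intro: pres_eq.refl pres_eq.sym pres_eq.trans)

lemma pres_eq_context: "pres_eq R v w \<Longrightarrow> pres_eq R (a @ v @ c) (a @ w @ c)"
proof (induction rule: pres_eq.induct)
  case (cancel u s b v)
  show ?case using pres_eq.cancel[of R "a @ u" s b "v @ c"] by simp
next
  case (relator r u v)
  show ?case using pres_eq.relator[OF relator, of "a @ u" "v @ c"] by simp
qed (blast intro: pres_eq.refl pres_eq.sym pres_eq.trans)+

lemma pres_eq_append:
  assumes "pres_eq R v v'" "pres_eq R w w'"
  shows "pres_eq R (v @ w) (v' @ w')"
  using pres_eq_context[OF assms(1), of "[]" w] pres_eq_context[OF assms(2), of v' "[]"]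
  by (auto intro: pres_eq.trans)

lemma presented_group_mult:
  "pres_rel R `` {v} \<otimes>\<^bsub>presented_group R\<^esub> pres_rel R `` {w} = pres_rel R `` {v @ w}"
proof -
  have "pres_rel R `` {x @ y} = pres_rel R `` {v @ w}"
    if "x \<in> pres_rel R `` {v}" "y \<in> pres_rel R `` {w}" for x y
    using that pres_eq_append[of R v x w y]
    by (intro equiv_class_eq[OF equiv_pres_rel]) (auto simp: pres_rel_def intro: pres_eq.sym)
  then have "(\<Union>x\<in>pres_rel R `` {v}. \<Union>y\<in>pres_rel R `` {w}. pres_rel R `` {x @ y}) =
      (\<Union>x\<in>pres_rel R `` {v}. \<Union>y\<in>pres_rel R `` {w}. pres_rel R `` {v @ w})"
    by (intro SUP_cong HOL.refl)
  moreover have "v \<in> pres_rel R `` {v}" "w \<in> pres_rel R `` {w}"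
    by (auto simp: pres_rel_def intro: pres_eq.refl)
  then have "pres_rel R `` {v} \<noteq> {}" "pres_rel R `` {w} \<noteq> {}"
    by blast+
  ultimately show ?thesis by (simp only: presented_group_def monoid.simps UN_constant if_False)
qed

definition inv_word :: "'s word \<Rightarrow> 's word" where
  "inv_word w = rev (map (\<lambda>(s, b). (s, \<not> b)) w)"

lemma pres_eq_inv_word: "pres_eq R (inv_word w @ w) []"
proof (induction w)
  case Nil
  show ?case by (simp add: inv_word_def pres_eq.refl)
next
  case (Cons x w)
  obtain s b where x: "x = (s, b)" by (cases x)
  have "pres_eq R (inv_word (x # w) @ x # w) (inv_word w @ w)"
    using pres_eq.cancel[of R "inv_word w" s "\<not> b" w] by (simp add: inv_word_def x)
  then show ?case using Cons pres_eq.trans by blast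
qed

lemma group_presented_group: "group (presented_group R)"
proof (rule groupI)
  let ?G = "presented_group R"
  have car: "carrier ?G = range (\<lambda>w. pres_rel R `` {w})"
    by (auto simp: presented_group_def quotient_def)
  have one: "\<one>\<^bsub>?G\<^esub> = pres_rel R `` {[]}" by (simp add: presented_group_def)
  show "\<one>\<^bsub>?G\<^esub> \<in> carrier ?G" by (simp add: car one)
  show "x \<otimes>\<^bsub>?G\<^esub> y \<in> carrier ?G" if "x \<in> carrier ?G" "y \<in> carrier ?G" for x y
    using that by (auto simp: car presented_group_mult)
  show "x \<otimes>\<^bsub>?G\<^esub> y \<otimes>\<^bsub>?G\<^esub> z = x \<otimes>\<^bsub>?G\<^esub> (y \<otimes>\<^bsub>?G\<^esub> z)"
    if "x \<in> carrier ?G" "y \<in> carrier ?G" "z \<in> carrier ?G" for x y z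
    using that by (auto simp: car presented_group_mult)
  show "\<one>\<^bsub>?G\<^esub> \<otimes>\<^bsub>?G\<^esub> x = x" if "x \<in> carrier ?G" for x
    using that by (auto simp: car one presented_group_mult)
  show "\<exists>y\<in>carrier ?G. y \<otimes>\<^bsub>?G\<^esub> x = \<one>\<^bsub>?G\<^esub>" if x: "x \<in> carrier ?G" for x
  proof -
    obtain w where "x = pres_rel R `` {w}" using x by (auto simp: car)
    moreover have "pres_rel R `` {inv_word w @ w} = pres_rel R `` {[]}"
      by (intro equiv_class_eq[OF equiv_pres_rel]) (simp add: pres_rel_def pres_eq_inv_word)
    ultimately show ?thesis
      by (intro bexI[of _ "pres_rel R `` {inv_word w}"]) (auto simp: car one presented_group_mult)
  qed
qed

section \<open>Simply-laced Coxeter groups\<close>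

text \<open>The generating set \<open>S\<close> is the whole (finite) type \<open>'s\<close>, so \<open>n = CARD('s)\<close>.\<close>

definition simply_laced :: "('s \<Rightarrow> 's \<Rightarrow> nat) \<Rightarrow> bool" where
  "simply_laced m \<longleftrightarrow>
     (\<forall>s. m s s = 1) \<and> (\<forall>s t. m s t = m t s) \<and> (\<forall>s t. s \<noteq> t \<longrightarrow> m s t \<in> {2, 3})"

definition coxeter_relators :: "('s \<Rightarrow> 's \<Rightarrow> nat) \<Rightarrow> 's word set" where
  "coxeter_relators m = {concat (replicate (m s t) [(s, True), (t, True)]) | s t. True}"

definition coxeter_group :: "('s \<Rightarrow> 's \<Rightarrow> nat) \<Rightarrow> 's word set monoid" where
  "coxeter_group m = presented_group (coxeter_relators m)"

definition coxeter_gen :: "('s \<Rightarrow> 's \<Rightarrow> nat) \<Rightarrow> 's \<Rightarrow> 's word set" where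
  "coxeter_gen m s = pres_gen (coxeter_relators m) s"

definition coxeter_edges :: "('s \<Rightarrow> 's \<Rightarrow> nat) \<Rightarrow> 's set set" where
  "coxeter_edges m = {{s, t} | s t. m s t = 3}"

section \<open>The flipping group\<close>

definition GL :: "('a::field ^ 'n ^ 'n) monoid" where
  "GL = \<lparr>carrier = {A. invertible A}, mult = (**), one = mat 1\<rparr>"

lemma group_GL: "group (GL :: ('a::field ^ 'n ^ 'n) monoid)"
proof (rule groupI)
  fix A :: "'a ^ 'n ^ 'n"
  assume "A \<in> carrier GL"
  then obtain B where "A ** B = mat 1" "B ** A = mat 1"
    by (auto simp: GL_def invertible_def)
  then show "\<exists>B\<in>carrier GL. B \<otimes>\<^bsub>GL\<^esub> A = \<one>\<^bsub>GL\<^esub>"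
    by (auto simp: GL_def invertible_def)
next
  show "\<one>\<^bsub>GL\<^esub> \<in> carrier (GL :: ('a ^ 'n ^ 'n) monoid)"
    by (auto simp: GL_def invertible_def intro!: exI[of _ "mat 1"])
qed (auto simp: GL_def invertible_mult matrix_mul_assoc)

definition flip_matrix :: "('s \<Rightarrow> 's \<Rightarrow> nat) \<Rightarrow> 's \<Rightarrow> bit ^ 's ^ 's" where
  "flip_matrix m s = (\<chi> u v. if u = v \<or> (v = s \<and> {u, v} \<in> coxeter_edges m) then 1 else 0)"

definition flipping_group :: "('s::finite \<Rightarrow> 's \<Rightarrow> nat) \<Rightarrow> (bit ^ 's ^ 's) monoid" where
  "flipping_group m = subgroup_generated GL (range (flip_matrix m))"

text \<open>
  \<^const>\<open>subgroup_generated\<close> silently discards generators outside the carrier; the following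
  shows that none is discarded here.
\<close>

lemma sum_two_deltas:
  fixes c :: "'a::comm_ring_1" and f :: "'s::finite \<Rightarrow> 'a"
  shows "(\<Sum>k\<in>UNIV. ((if k = u then 1 else 0) + (if k = s then c else 0)) * f k) = f u + c * f s"
proof -
  have "(\<Sum>k\<in>UNIV. ((if k = u then 1 else 0) + (if k = s then c else 0)) * f k) =
      (\<Sum>k\<in>UNIV. (if k = u then f k else 0) + (if k = s then c * f k else 0))"
    by (intro sum.cong) (simp_all add: distrib_right)
  then show ?thesis by (simp add: sum.distrib)
qed

lemma flip_matrix_square:
  fixes m :: "'s::finite \<Rightarrow> 's \<Rightarrow> nat"
  assumes "simply_laced m"
  shows "flip_matrix m s ** flip_matrix m s = mat 1"
proof -
  have no_loop: "{s} \<notin> coxeter_edges m"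
    using assms by (auto simp: coxeter_edges_def simply_laced_def doubleton_eq_iff)
  have split: "flip_matrix m s $ u $ k =
      (if k = u then 1 else 0) + (if k = s then (if {u, s} \<in> coxeter_edges m then 1 else 0) else 0)"
    for u k using no_loop by (auto simp: flip_matrix_def)
  have "(\<Sum>k\<in>UNIV. flip_matrix m s $ u $ k * flip_matrix m s $ k $ v) = (if u = v then 1 else 0)"
    for u v
    unfolding split[of u] sum_two_deltas using no_loop by (auto simp: flip_matrix_def)
  then show ?thesis by (simp add: vec_eq_iff matrix_matrix_mult_def mat_def)
qed

lemma flip_matrix_in_GL: "simply_laced m \<Longrightarrow> flip_matrix m s \<in> carrier GL"
  using flip_matrix_square[of m s] by (auto simp: GL_def invertible_def)

end

theory Submission
  imports Defs
begin

text \<open>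
  Multiplying \<open>M\<close> on the left by the flip matrix of \<open>s\<close> adds row \<open>s\<close> to the rows of all neighbours
  of \<open>s\<close>. Comparing rows over the field with two elements, flip matrices of non-adjacent vertices
  commute and those of adjacent vertices satisfy the braid relation; as they are involutions, they
  satisfy the Coxeter relations. The homomorphism then comes from the universal property of a
  presentation.
\<close>

section \<open>The universal property of a presented group\<close>

text \<open>The product is nested to the right and ends in \<open>\<one>\<close>. The matrix
  relations proved later carry a trailing factor \<open>M\<close> so that they rewrite inside
  products of this shape.\<close>

definition (in group) word_eval :: "('s \<Rightarrow> 'a) \<Rightarrow> 's word \<Rightarrow> 'a" where
  "word_eval f w = foldr (\<lambda>(s, b) x. (if b then f s else inv (f s)) \<otimes> x) w \<one>"

context group
begin

lemma word_eval_Nil [simp]: "word_eval f [] = \<one>"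
  by (simp add: word_eval_def)

lemma word_eval_Cons [simp]:
  "word_eval f ((s, b) # w) = (if b then f s else inv (f s)) \<otimes> word_eval f w"
  by (simp add: word_eval_def)

lemma word_eval_in_generate:
  assumes "range f \<subseteq> carrier G"
  shows "word_eval f w \<in> generate G (range f)"
proof (induction w)
  case Nil
  show ?case by (simp add: generate.one)
next
  case (Cons x w)
  then show ?case
    by (cases x) (auto intro: generate.eng generate.incl generate.inv)
qed

lemma word_eval_closed [simp]: "range f \<subseteq> carrier G \<Longrightarrow> word_eval f w \<in> carrier G"
  using word_eval_in_generate generate_in_carrier by blast

lemma word_eval_append:
  assumes "range f \<subseteq> carrier G"
  shows "word_eval f (v @ w) = word_eval f v \<otimes> word_eval f w"
proof (induction v)
  case (Cons x v)
  obtain s b where "x = (s, b)" by (cases x)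
  moreover have "f s \<in> carrier G" using assms by auto
  ultimately show ?case using Cons assms by (simp add: m_assoc)
qed (use assms in simp)

text \<open>Concatenating words multiplies their values, so these values are closed under products.
  This identifies the image of the induced homomorphism and hence gives surjectivity.\<close>

lemma generate_eq_range_word_eval:
  assumes "range f \<subseteq> carrier G"
  shows "generate G (range f) = range (word_eval f)"
proof
  have in_carrier: "f s \<in> carrier G" for s using assms by auto
  have "x \<in> range (word_eval f)" if "x \<in> generate G (range f)" for x
    using that
  proof (induction rule: generate.induct)
    case one
    show ?case by (rule range_eqI[of _ _ "[]"]) simp
  next
    case (incl h)
    then obtain s where "h = f s" by auto
    then show ?case by (intro range_eqI[of _ _ "[(s, True)]"]) (simp add: in_carrier)
  next
    case (inv h)
    then obtain s where "h = f s" by auto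
    then show ?case by (intro range_eqI[of _ _ "[(s, False)]"]) (simp add: in_carrier)
  next
    case (eng h1 h2)
    then obtain v w where "h1 = word_eval f v" "h2 = word_eval f w" by auto
    then show ?case by (intro range_eqI[of _ _ "v @ w"]) (simp add: word_eval_append[OF assms])
  qed
  then show "generate G (range f) \<subseteq> range (word_eval f)" by blast
  show "range (word_eval f) \<subseteq> generate G (range f)"
    using word_eval_in_generate[OF assms] by blast
qed

text \<open>Each cancellation or relator step removes a factor with value \<open>\<one>\<close>, so
  evaluation is constant on the classes of words.\<close>

lemma word_eval_pres_eq:
  assumes "pres_eq R v w" "range f \<subseteq> carrier G" "\<And>r. r \<in> R \<Longrightarrow> word_eval f r = \<one>"
  shows "word_eval f v = word_eval f w"
  using assms(1)
proof (induction rule: pres_eq.induct)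
  case (cancel u s b v)
  have "f s \<in> carrier G" using assms(2) by auto
  then have "word_eval f [(s, b), (s, \<not> b)] = \<one>" by simp
  then have "word_eval f ([(s, b), (s, \<not> b)] @ v) = word_eval f v"
    unfolding word_eval_append[OF assms(2)] using assms(2) by simp
  then show ?case by (simp only: word_eval_append[OF assms(2)])
next
  case (relator r u v)
  then show ?case using assms(2,3) by (simp add: word_eval_append)
qed simp_all

lemma presented_group_hom_exists:
  assumes f: "range f \<subseteq> carrier G" and R: "\<And>r. r \<in> R \<Longrightarrow> word_eval f r = \<one>"
  shows "\<exists>\<phi>. \<phi> \<in> hom (presented_group R) G \<and> (\<forall>s. \<phi> (pres_gen R s) = f s) \<and>
             \<phi> ` carrier (presented_group R) = generate G (range f)"
proof -
  \<comment> \<open>\<open>the_elem\<close> is meaningful here because evaluation maps each class,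
    nonempty by reflexivity, onto a singleton.\<close>
  define \<phi> where "\<phi> X = the_elem (word_eval f ` X)" for X
  have \<phi>: "\<phi> (pres_rel R `` {w}) = word_eval f w" for w
  proof -
    have "word_eval f ` (pres_rel R `` {w}) = {word_eval f w}"
      using word_eval_pres_eq[OF _ f R] by (force simp: pres_rel_def intro: pres_eq.refl)
    then show ?thesis by (simp add: \<phi>_def)
  qed
  have carrier: "carrier (presented_group R) = range (\<lambda>w. pres_rel R `` {w})"
    by (auto simp: presented_group_def quotient_def)
  have "\<phi> \<in> hom (presented_group R) G"
    by (rule homI) (auto simp: carrier \<phi> f presented_group_mult word_eval_append)
  moreover have "\<phi> (pres_gen R s) = f s" for s
  proof -
    have "f s \<in> carrier G" using f by auto
    then show ?thesis by (simp add: pres_gen_def \<phi>)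
  qed
  moreover have "\<phi> ` carrier (presented_group R) = generate G (range f)"
    by (simp add: carrier image_image \<phi> generate_eq_range_word_eval[OF f])
  ultimately show ?thesis by blast
qed

end

section \<open>The Coxeter relations for the flip matrices\<close>

lemma mem_coxeter_edges_iff:
  assumes "simply_laced m"
  shows "{u, v} \<in> coxeter_edges m \<longleftrightarrow> m u v = 3"
proof -
  have "m u v = m v u" using assms unfolding simply_laced_def by blast
  then show ?thesis by (auto simp: coxeter_edges_def doubleton_eq_iff)
qed

lemma flip_matrix_mult:
  fixes m :: "'s::finite \<Rightarrow> 's \<Rightarrow> nat"
  assumes "simply_laced m"
  shows "(flip_matrix m s ** M) $ u $ v = M $ u $ v + of_bool (m u s = 3) * M $ s $ v"
proof -
  have no_loop: "m s s \<noteq> 3" using assms by (simp add: simply_laced_def)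
  \<comment> \<open>For \<open>k = u = s\<close> both deltas could contribute, and 1 + 1 = 0 would
    spoil the diagonal entry; \<open>no_loop\<close> rules this out.\<close>
  have "flip_matrix m s $ u $ k =
      (if k = u then 1 else 0) + (if k = s then of_bool (m u s = 3) else 0)" for k
    using no_loop by (auto simp: flip_matrix_def mem_coxeter_edges_iff[OF assms])
  then have "(flip_matrix m s ** M) $ u $ v = (\<Sum>k\<in>UNIV.
      ((if k = u then 1 else 0) + (if k = s then of_bool (m u s = 3) else 0)) * M $ k $ v)"
    unfolding matrix_matrix_mult_def by (simp only: vec_lambda_beta)
  then show ?thesis by (simp only: sum_two_deltas)
qed

text \<open>Neither factor changes the row that the other one adds, so both orders add the same
  multiples of rows \<open>s\<close> and \<open>t\<close> of \<open>M\<close> to row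
  \<open>u\<close>.\<close>

lemma flip_matrix_commute:
  fixes m :: "'s::finite \<Rightarrow> 's \<Rightarrow> nat"
  assumes "simply_laced m" "m s t = 2"
  shows "flip_matrix m s ** (flip_matrix m t ** M) = flip_matrix m t ** (flip_matrix m s ** M)"
proof -
  have "m t s = 2" using assms unfolding simply_laced_def by metis
  then have entries: "(flip_matrix m s ** M) $ t $ v = M $ t $ v"
      "(flip_matrix m t ** M) $ s $ v = M $ s $ v" for M v
    by (simp_all add: flip_matrix_mult[OF assms(1)] assms(2))
  have "(flip_matrix m s ** (flip_matrix m t ** M)) $ u $ v =
      (flip_matrix m t ** (flip_matrix m s ** M)) $ u $ v" for u v
    unfolding flip_matrix_mult[OF assms(1), of _ _ u] entries by (simp only: add_ac)
  then show ?thesis by (simp add: vec_eq_iff)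
qed

lemma flip_matrix_braid:
  fixes m :: "'s::finite \<Rightarrow> 's \<Rightarrow> nat"
  assumes "simply_laced m" "m s t = 3"
  shows "flip_matrix m s ** (flip_matrix m t ** (flip_matrix m s ** M)) =
    flip_matrix m t ** (flip_matrix m s ** (flip_matrix m t ** M))"
proof -
  have m: "m t s = 3" "m s s = 1" "m t t = 1" using assms unfolding simply_laced_def by metis+
  \<comment> \<open>Here \<open>x\<close>, \<open>y\<close>, \<open>z\<close> are the entries of
    rows \<open>u\<close>, \<open>s\<close>, \<open>t\<close> of \<open>M\<close> in one column, and
    \<open>a\<close>, \<open>b\<close> say whether \<open>u\<close> is adjacent to \<open>s\<close>,
    \<open>t\<close>. In characteristic 2 both sides equal
    \<open>x + (a + b) * (y + z)\<close>.\<close>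
  have bits: "x + a * y + b * (z + y) + a * (y + (z + y)) =
      x + b * z + a * (y + z) + b * (z + (y + z))" for x y z a b :: bit
    by (cases x; cases y; cases z; cases a; cases b) simp_all
  have entries: "(flip_matrix m s ** M) $ s $ v = M $ s $ v"
      "(flip_matrix m s ** M) $ t $ v = M $ t $ v + M $ s $ v"
      "(flip_matrix m t ** M) $ t $ v = M $ t $ v"
      "(flip_matrix m t ** M) $ s $ v = M $ s $ v + M $ t $ v" for M v
    by (simp_all only: flip_matrix_mult[OF assms(1)] assms(2) m) simp_all
  have "(flip_matrix m s ** (flip_matrix m t ** (flip_matrix m s ** M))) $ u $ v =
      (flip_matrix m t ** (flip_matrix m s ** (flip_matrix m t ** M))) $ u $ v" for u v
    unfolding flip_matrix_mult[OF assms(1), of _ _ u] entries by (rule bits)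
  then show ?thesis by (simp add: vec_eq_iff)
qed

lemma flip_matrix_relator:
  fixes m :: "'s::finite \<Rightarrow> 's \<Rightarrow> nat"
  assumes m: "simply_laced m" and r: "r \<in> coxeter_relators m"
  shows "group.word_eval GL (flip_matrix m) r = mat 1"
proof -
  interpret group "GL :: (bit ^ 's ^ 's) monoid" by (rule group_GL)
  obtain s t where r_eq: "r = concat (replicate (m s t) [(s, True), (t, True)])"
    using r by (auto simp: coxeter_relators_def)
  let ?s = "flip_matrix m s" and ?t = "flip_matrix m t"
  have GL: "\<one>\<^bsub>GL\<^esub> = mat 1" "A \<otimes>\<^bsub>GL\<^esub> B = A ** B" for A B :: "bit ^ 's ^ 's"
    by (simp_all add: GL_def)
  have square: "flip_matrix m x ** (flip_matrix m x ** A) = A" for x A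
    by (simp add: matrix_mul_assoc flip_matrix_square[OF m])
  \<comment> \<open>A diagonal relator is the word \<open>s s\<close>, so its case is just the
    involution property.\<close>
  consider "s = t" "m s t = 1" | "m s t = 2" | "m s t = 3"
    using m unfolding simply_laced_def insert_iff empty_iff by metis
  then show ?thesis
  proof cases
    case 1
    then show ?thesis by (simp add: r_eq GL flip_matrix_square[OF m])
  next
    case 2
    have "word_eval (flip_matrix m) r = ?s ** (?t ** (?s ** (?t ** mat 1)))"
      by (simp add: r_eq 2 numeral_2_eq_2 GL)
    \<comment> \<open>Swapping commuting factors brings equal involutions together, and they
      cancel.\<close>
    also have "\<dots> = mat 1"
      by (simp only: flip_matrix_commute[OF m 2] square)
    finally show ?thesis .
  next
    case 3
    have "word_eval (flip_matrix m) r = ?s ** (?t ** (?s ** (?t ** (?s ** (?t ** mat 1)))))"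
      by (simp add: r_eq 3 numeral_3_eq_3 GL)
    \<comment> \<open>A braid move turns \<open>sts\<close> into \<open>tst\<close>; what results
      collapses by cancelling squares.\<close>
    also have "\<dots> = mat 1"
      by (simp only: flip_matrix_braid[OF m 3] square)
    finally show ?thesis .
  qed
qed

theorem theorem3p2:
  fixes m :: "'s::finite \<Rightarrow> 's \<Rightarrow> nat"
  assumes "simply_laced m"
  shows "\<exists>\<phi>. \<phi> \<in> epi (coxeter_group m) (flipping_group m) \<and>
             (\<forall>s. \<phi> (coxeter_gen m s) = flip_matrix m s) \<and>
             group_hom (coxeter_group m) (GL :: (bit ^ 's ^ 's) monoid) \<phi>"
proof -
  interpret group "GL :: (bit ^ 's ^ 's) monoid" by (rule group_GL)
  have range: "range (flip_matrix m) \<subseteq> carrier GL"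
    using flip_matrix_in_GL[OF assms] by auto
  have "word_eval (flip_matrix m) r = \<one>\<^bsub>GL\<^esub>" if "r \<in> coxeter_relators m" for r
    using flip_matrix_relator[OF assms that] by (simp add: GL_def)
  then obtain \<phi> where \<phi>: "\<phi> \<in> hom (coxeter_group m) GL"
      "\<And>s. \<phi> (coxeter_gen m s) = flip_matrix m s"
      "\<phi> ` carrier (coxeter_group m) = generate GL (range (flip_matrix m))"
    unfolding coxeter_group_def coxeter_gen_def using presented_group_hom_exists[OF range] by blast
  \<comment> \<open>\<open>subgroup_generated\<close> first intersects the generators with the
    carrier; by \<open>range\<close> this discards nothing.\<close>
  have carrier: "carrier (flipping_group m) = generate GL (range (flip_matrix m))"
    using range by (simp add: flipping_group_def carrier_subgroup_generated Int_absorb1)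
  have "\<phi> \<in> hom (coxeter_group m) (flipping_group m)"
    using \<phi>(1,3) carrier by (auto simp: hom_def flipping_group_def)
  then have "\<phi> \<in> epi (coxeter_group m) (flipping_group m)"
    using \<phi>(3) carrier by (simp add: epi_def)
  \<comment> \<open>The same map, with all of \<open>GL\<close> as target, is the representation
    over the field with two elements.\<close>
  moreover have "group_hom (coxeter_group m) GL \<phi>"
    using \<phi>(1) group_presented_group[of "coxeter_relators m"]
    by (intro group_hom.intro group_hom_axioms.intro) (auto simp: coxeter_group_def is_group)
  ultimately show ?thesis using \<phi>(2) by blast
qed

end
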